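(* Let $\frac12<p<1$, and put $\beta=\frac{p}{2p-1}$ and $\gamma=\frac{1-p}{p}$. Let $(d_k)_{k=0}^\infty$ be the unique positive bounded sequence satisfying $$d_0=\frac{1-p}{p},\qquad d_k=\frac{pk\,d_{k-1}+(1-p)k\,d_{k+1}}{k+p}\quad (k\ge 1).$$ Then, as $k\to\infty$, $$d_k\sim \gamma\,\beta^{\beta}\,\Gamma(\beta+1)\,k^{-\beta}.$$
   Context: $\Gamma$ is the Gamma function, and $a_k\sim b_k$ means $a_k/b_k\to 1$ as $k\to\infty$. *)

theory Defs
  imports "HOL-Analysis.Analysis" "HOL-Library.Landau_Symbols"
begin

(* In the recurrence "k - 1" is natural-number subtraction; it is exact because k \<ge> 1. *)
definition admissible_seq :: "real \<Rightarrow> (nat \<Rightarrow> real) \<Rightarrow> bool" where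
  "admissible_seq p d \<longleftrightarrow>
     (\<forall>k. 0 < d k) \<and> bounded (range d) \<and>
     d 0 = (1 - p) / p \<and>
     (\<forall>k\<ge>1. d k = (p * real k * d (k - 1) + (1 - p) * real k * d (k + 1)) / (real k + p))"

end

theory Submission
  imports Defs
begin

text \<open>
  The moments of the weight
  \<open>w t = (1 - t)\<^bsup>\<beta> - 1\<^esup> (p - (1 - p) t)\<^bsup>-\<beta> - 1\<^esup>\<close> on \<open>[0, 1]\<close>
  solve the recurrence: \<open>t - p - (1 - p) t\<^sup>2 = -(1 - t) (p - (1 - p) t)\<close>, and
  \<open>u t = (1 - t) (p - (1 - p) t) w t\<close> satisfies \<open>u' = -p w\<close>, so integrating the derivative of
  \<open>t\<^sup>k u t\<close> gives the recurrence for \<open>k \<ge> 1\<close> and the value of the moment for \<open>k = 0\<close>.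
  The mass of \<open>t\<^sup>k w t\<close> concentrates at \<open>t = 1\<close>, where the second factor of \<open>w\<close> is Lipschitz, so
  the moments are asymptotic to a multiple of \<open>Beta (k + 1) \<beta>\<close>.
  Uniqueness holds because a solution of the recurrence that vanishes at \<open>0\<close> and is not
  identically zero grows at least linearly.
\<close>

section \<open>The weight on the unit interval and its moments\<close>

definition weight :: "real \<Rightarrow> real \<Rightarrow> real \<Rightarrow> real" where
  "weight p b t = (1 - t) powr (b - 1) * (p - (1 - p) * t) powr (- b - 1)"

definition moment :: "real \<Rightarrow> real \<Rightarrow> nat \<Rightarrow> real" where
  "moment p b k = integral {0..1} (\<lambda>t. t ^ k * weight p b t)"

lemma denominator_ge:
  fixes p t :: real
  assumes "p < 1" "t \<le> 1"
  shows "2 * p - 1 \<le> p - (1 - p) * t"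
proof -
  have "(1 - p) * t \<le> (1 - p) * 1"
    using assms by (intro mult_left_mono) auto
  then show ?thesis by simp
qed

lemma denominator_pos:
  fixes p t :: real
  assumes "1 / 2 < p" "p < 1" "t \<le> 1"
  shows "0 < p - (1 - p) * t"
  using denominator_ge[OF assms(2,3)] assms(1) by linarith

text \<open>\<open>1 < b\<close> makes the exponent of \<open>1 - t\<close> positive, so the weight
  tends to its value 0 at \<open>t = 1\<close>; the other base stays positive.\<close>

lemma continuous_on_weight:
  assumes "1 / 2 < p" "p < 1" "1 < b"
  shows "continuous_on {0..1} (weight p b)"
  unfolding weight_def
  using denominator_pos[OF assms(1,2)] assms(3)
  by (intro continuous_intros continuous_on_powr') force+

lemma integrable_power_weight:
  assumes "1 / 2 < p" "p < 1" "1 < b"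
  shows "(\<lambda>t. t ^ k * weight p b t) integrable_on {0..1}"
  by (intro integrable_continuous_interval continuous_intros continuous_on_weight assms)

lemma has_integral_power_weight:
  assumes "1 / 2 < p" "p < 1" "1 < b"
  shows "((\<lambda>t. t ^ k * weight p b t) has_integral moment p b k) {0..1}"
  unfolding moment_def using integrable_power_weight[OF assms] by (rule integrable_integral)

section \<open>Integration by parts and the recurrence for the moments\<close>

text \<open>With \<open>x = 1 - t\<close> and \<open>y = p - (1 - p) * t\<close>, the logarithmic
  derivative is \<open>b * ((1 - p) * x - y) / (x * y)\<close>. Its numerator is constant, and the
  choice of \<open>b\<close> makes it \<open>- p\<close>.\<close>

lemma weight_antiderivative:
  assumes "1 / 2 < p" "p < 1" "b = p / (2 * p - 1)" "t < 1"
  shows "((\<lambda>t. (1 - t) powr b * (p - (1 - p) * t) powr (- b)) has_real_derivative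
           - p * weight p b t) (at t)"
proof -
  define x y where "x = 1 - t" and "y = p - (1 - p) * t"
  have pos: "0 < x" "0 < y"
    using assms denominator_pos[of p t] by (auto simp: x_def y_def)
  have "((\<lambda>t. (1 - t) powr b * (p - (1 - p) * t) powr (- b)) has_real_derivative
          - b * x powr (b - 1) * y powr (- b) + x powr b * (b * (1 - p) * y powr (- b - 1))) (at t)"
    using pos unfolding x_def y_def
    by (auto intro!: derivative_eq_intros simp: algebra_simps)
  also have "- b * x powr (b - 1) * y powr (- b) + x powr b * (b * (1 - p) * y powr (- b - 1))
      = x powr (b - 1) * y powr (- b - 1) * (b * ((1 - p) * x - y))"
  proof -
    have "x powr b = x powr (b - 1) * x" "y powr (- b) = y powr (- b - 1) * y"
      using pos by (simp_all add: powr_diff)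
    then show ?thesis by (simp add: algebra_simps)
  qed
  also have "b * ((1 - p) * x - y) = - p"
  proof -
    have "(1 - p) * x - y = - (2 * p - 1)" by (simp add: x_def y_def algebra_simps)
    then show ?thesis using assms(1,3) by (simp only:) (simp add: field_simps)
  qed
  finally show ?thesis by (simp add: weight_def x_def y_def mult_ac)
qed

text \<open>The integrand is the derivative of \<open>t ^ k * u t\<close>. The boundary term at 1
  vanishes since \<open>b > 0\<close>; at 0 it survives only for \<open>k = 0\<close>, where
  \<open>0 ^ 0 = 1\<close>. In that case the factor \<open>real k\<close> hides the truncated
  \<open>k - 1\<close>.\<close>

lemma moment_integration_by_parts:
  assumes p: "1 / 2 < p" "p < 1" and b: "b = p / (2 * p - 1)" "1 < b"
  shows "((\<lambda>t. real k * t ^ (k - 1) * ((1 - t) * (p - (1 - p) * t) * weight p b t)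
            - p * (t ^ k * weight p b t))
          has_integral (if k = 0 then - (p powr (- b)) else 0)) {0..1}"
proof -
  define F where "F t = t ^ k * ((1 - t) powr b * (p - (1 - p) * t) powr (- b))" for t
  have "((\<lambda>t. real k * t ^ (k - 1) * ((1 - t) * (p - (1 - p) * t) * weight p b t)
            - p * (t ^ k * weight p b t)) has_integral (F 1 - F 0)) {0..1}"
  \<comment> \<open>The derivative formula is available only for \<open>t < 1\<close>; continuity of
    \<open>F\<close> covers the right endpoint.\<close>
  proof (rule fundamental_theorem_of_calculus_interior)
    show "continuous_on {0..1} F"
      unfolding F_def using denominator_pos[OF p] b
      by (intro continuous_intros continuous_on_powr') force+
  next
    fix t :: real assume t: "t \<in> {0<..<1}"
    have pos: "0 < 1 - t" "0 < p - (1 - p) * t"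
      using t denominator_pos[OF p, of t] by auto
    have u: "(1 - t) powr b * (p - (1 - p) * t) powr (- b)
        = (1 - t) * (p - (1 - p) * t) * weight p b t"
      using pos by (simp add: weight_def powr_diff)
    have "(F has_real_derivative
        real k * t ^ (k - 1) * ((1 - t) powr b * (p - (1 - p) * t) powr (- b))
        + t ^ k * (- p * weight p b t)) (at t)"
      unfolding F_def
      by (rule derivative_eq_intros weight_antiderivative[OF p b(1)] refl | use t in force)+
    then show "(F has_vector_derivative
        real k * t ^ (k - 1) * ((1 - t) * (p - (1 - p) * t) * weight p b t)
            - p * (t ^ k * weight p b t)) (at t)"
      unfolding u by (simp add: has_real_derivative_iff_has_vector_derivative algebra_simps)
  qed auto
  moreover have "F 1 - F 0 = (if k = 0 then - (p powr (- b)) else 0)"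
    using b p by (simp add: F_def)
  ultimately show ?thesis by simp
qed

lemma moment_0:
  assumes p: "1 / 2 < p" "p < 1" and b: "b = p / (2 * p - 1)" "1 < b"
  shows "p * moment p b 0 = p powr (- b)"
proof -
  have "((\<lambda>t. - p * (t ^ 0 * weight p b t)) has_integral (- p * moment p b 0)) {0..1}"
    by (intro has_integral_mult_right has_integral_power_weight p b)
  moreover have "((\<lambda>t. - p * (t ^ 0 * weight p b t)) has_integral - (p powr (- b))) {0..1}"
    using moment_integration_by_parts[OF p b, of 0] by simp
  ultimately have "- p * moment p b 0 = - (p powr (- b))"
    by (rule has_integral_unique)
  then show ?thesis by simp
qed

lemma moment_recurrence:
  assumes p: "1 / 2 < p" "p < 1" and b: "b = p / (2 * p - 1)" "1 < b" and "1 \<le> k"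
  shows "(real k + p) * moment p b k
    = p * real k * moment p b (k - 1) + (1 - p) * real k * moment p b (k + 1)"
proof -
  let ?f = "\<lambda>j t. t ^ j * weight p b t"
  have "((\<lambda>t. p * real k * ?f (k - 1) t + (1 - p) * real k * ?f (k + 1) t
        - (real k + p) * ?f k t) has_integral
      (p * real k * moment p b (k - 1) + (1 - p) * real k * moment p b (k + 1)
        - (real k + p) * moment p b k)) {0..1}"
    by (intro has_integral_diff has_integral_add has_integral_mult_right
        has_integral_power_weight p b)
  \<comment> \<open>Expanding \<open>(1 - t) * (p - (1 - p) * t) = p - t + (1 - p) * t ^ 2\<close>
    identifies the combination of three consecutive moments with the integrand by parts.\<close>
  also have "(\<lambda>t. p * real k * ?f (k - 1) t + (1 - p) * real k * ?f (k + 1) t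
        - (real k + p) * ?f k t)
      = (\<lambda>t. real k * t ^ (k - 1) * ((1 - t) * (p - (1 - p) * t) * weight p b t)
            - p * ?f k t)"
  proof
    fix t :: real
    have "t ^ k = t ^ (k - 1) * t" "t ^ (k + 1) = t ^ (k - 1) * t * t"
      using \<open>1 \<le> k\<close> by (cases k; simp)+
    then show "p * real k * ?f (k - 1) t + (1 - p) * real k * ?f (k + 1) t
        - (real k + p) * ?f k t
        = real k * t ^ (k - 1) * ((1 - t) * (p - (1 - p) * t) * weight p b t) - p * ?f k t"
      by (simp add: algebra_simps)
  qed
  finally have "p * real k * moment p b (k - 1) + (1 - p) * real k * moment p b (k + 1)
      - (real k + p) * moment p b k = (if k = 0 then - (p powr (- b)) else 0)"
    using moment_integration_by_parts[OF p b] by (rule has_integral_unique)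
  then show ?thesis using \<open>1 \<le> k\<close> by simp
qed

section \<open>Asymptotics of the moments by comparison with the Beta function\<close>

lemma has_integral_Beta_power:
  fixes a :: real
  assumes "0 < a"
  shows "((\<lambda>t. t ^ k * (1 - t) powr (a - 1)) has_integral Beta (real k + 1) a) {0..1}"
\<comment> \<open>For \<open>k = 0\<close> the integrands differ at \<open>t = 0\<close>:
  \<open>0 ^ 0 = 1\<close> but \<open>0 powr 0 = 0\<close>.\<close>
proof (rule has_integral_spike[of "{0}"])
  show "((\<lambda>t. t powr (real k + 1 - 1) * (1 - t) powr (a - 1)) has_integral
      Beta (real k + 1) a) {0..1}"
    using assms by (intro has_integral_Beta_real) auto
qed (auto simp: powr_realpow)

text \<open>For \<open>k > 0\<close> the term is Euler's
  \<open>k! * k powr a / (a * (a + 1) * ... * (a + k))\<close>, whose limit is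
  \<open>Gamma a\<close>.\<close>

lemma Beta_nat_asymp:
  fixes a :: real
  assumes "0 < a"
  shows "(\<lambda>k. Beta (real k + 1) a * real k powr a) \<longlonglongrightarrow> Gamma a"
proof (rule Lim_transform_eventually[OF Gamma_series_LIMSEQ])
  show "\<forall>\<^sub>F k in sequentially. Gamma_series a k = Beta (real k + 1) a * real k powr a"
    using eventually_gt_at_top[of 0]
  proof eventually_elim
    case (elim k)
    have "a \<notin> \<int>\<^sub>\<le>\<^sub>0" using assms by (auto elim!: nonpos_Ints_cases)
    then have "pochhammer a (k + 1) = Gamma (a + real (k + 1)) / Gamma a"
      by (rule pochhammer_Gamma)
    then show ?case
      using elim by (simp add: Gamma_series_def Beta_def Gamma_fact powr_def add_ac flip: Gamma_fact)
  qed
qed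

text \<open>The second base has its minimum \<open>2 * p - 1\<close> at \<open>t = 1\<close> and its
  exponent is negative, so freezing that factor at 1 bounds the weight from above.\<close>

lemma moment_le_Beta:
  assumes p: "1 / 2 < p" "p < 1" and b: "1 < b"
  shows "moment p b k \<le> (2 * p - 1) powr (- b - 1) * Beta (real k + 1) b"
proof (rule has_integral_le[OF has_integral_power_weight[OF p b]
      has_integral_mult_right[OF has_integral_Beta_power]])
  fix t :: real assume t: "t \<in> {0..1}"
  have "(p - (1 - p) * t) powr (- b - 1) \<le> (2 * p - 1) powr (- b - 1)"
    using p b t denominator_ge[of p t] by (intro powr_mono2') auto
  then have "t ^ k * (1 - t) powr (b - 1) * (p - (1 - p) * t) powr (- b - 1)
      \<le> t ^ k * (1 - t) powr (b - 1) * (2 * p - 1) powr (- b - 1)"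
    using t by (intro mult_left_mono) auto
  then show "t ^ k * weight p b t \<le> (2 * p - 1) powr (- b - 1) * (t ^ k * (1 - t) powr (b - 1))"
    by (simp add: weight_def mult_ac)
qed (use b in simp)

text \<open>\<open>L\<close> bounds the derivative of the second factor, so freezing it at 1 costs
  at most \<open>L * (1 - t)\<close>. The extra \<open>1 - t\<close> raises the Beta parameter to
  \<open>b + 1\<close>, making the error smaller by order \<open>1 / k\<close>.\<close>

lemma moment_ge_Beta:
  assumes p: "1 / 2 < p" "p < 1" and b: "1 < b"
  defines "L \<equiv> (b + 1) * (1 - p) * (2 * p - 1) powr (- b - 2)"
  shows "(2 * p - 1) powr (- b - 1) * Beta (real k + 1) b - L * Beta (real k + 1) (b + 1)
    \<le> moment p b k"
proof (rule has_integral_le[OF has_integral_diff[OF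
        has_integral_mult_right[OF has_integral_Beta_power]
        has_integral_mult_right[OF has_integral_Beta_power]]
      has_integral_power_weight[OF p b]])
  fix t :: real assume t: "t \<in> {0..1}"
  let ?g = "\<lambda>t. (p - (1 - p) * t) powr (- b - 1)"
  have L: "?g 1 - ?g t \<le> L * (1 - t)"
  proof (cases "t = 1")
    case False
    then have "t < 1" using t by auto
    have "\<exists>z>t. z < 1 \<and> ?g 1 - ?g t
        = (1 - t) * ((b + 1) * (1 - p) * (p - (1 - p) * z) powr (- b - 2))"
    proof (rule MVT2[OF \<open>t < 1\<close>])
      fix x :: real assume "t \<le> x" "x \<le> 1"
      then have "0 < p - (1 - p) * x" using denominator_pos[OF p] by simp
      then show "(?g has_real_derivative (b + 1) * (1 - p) * (p - (1 - p) * x) powr (- b - 2)) (at x)"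
        by (auto intro!: derivative_eq_intros simp: algebra_simps)
    qed
    then obtain z where z: "t < z" "z < 1" "?g 1 - ?g t
        = (1 - t) * ((b + 1) * (1 - p) * (p - (1 - p) * z) powr (- b - 2))" by blast
    have "(p - (1 - p) * z) powr (- b - 2) \<le> (2 * p - 1) powr (- b - 2)"
      using p b z denominator_ge[of p z] by (intro powr_mono2') auto
    then have "(b + 1) * (1 - p) * (p - (1 - p) * z) powr (- b - 2) \<le> L"
      unfolding L_def using p b by (intro mult_left_mono) auto
    then show ?thesis
      unfolding z(3) using \<open>t < 1\<close> by (subst mult.commute) (intro mult_right_mono, auto)
  qed simp
  have "(1 - t) powr (b + 1 - 1) = (1 - t) powr (b - 1) * (1 - t)"
    using t by (cases "t = 1") (simp_all add: powr_diff)
  then have "(2 * p - 1) powr (- b - 1) * (t ^ k * (1 - t) powr (b - 1))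
      - L * (t ^ k * (1 - t) powr (b + 1 - 1))
      = t ^ k * (1 - t) powr (b - 1) * (?g 1 - L * (1 - t))"
    by (simp only:) (simp add: algebra_simps)
  also have "\<dots> \<le> t ^ k * (1 - t) powr (b - 1) * ?g t"
    using t L by (intro mult_left_mono) auto
  finally show "(2 * p - 1) powr (- b - 1) * (t ^ k * (1 - t) powr (b - 1))
      - L * (t ^ k * (1 - t) powr (b + 1 - 1)) \<le> t ^ k * weight p b t"
    by (simp only: weight_def mult.assoc)
qed (use b in simp_all)

lemma moment_asymp:
  assumes p: "1 / 2 < p" "p < 1" and b: "1 < b"
  shows "(\<lambda>k. moment p b k * real k powr b) \<longlonglongrightarrow> (2 * p - 1) powr (- b - 1) * Gamma b"
proof -
  define L where "L = (b + 1) * (1 - p) * (2 * p - 1) powr (- b - 2)"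
  let ?c = "(2 * p - 1) powr (- b - 1)"
  let ?B = "\<lambda>a k. Beta (real k + 1) a * real k powr a"
  have upper: "(\<lambda>k. ?c * ?B b k) \<longlonglongrightarrow> ?c * Gamma b"
    using b by (intro tendsto_intros Beta_nat_asymp) auto
  \<comment> \<open>\<open>Beta (k + 1) (b + 1)\<close> is balanced by \<open>k powr (b + 1)\<close>
    but multiplied only by \<open>k powr b\<close>; the leftover \<open>inverse (real k)\<close>
    makes the error vanish.\<close>
  have "(\<lambda>k. ?c * ?B b k - L * (?B (b + 1) k * inverse (real k)))
      \<longlonglongrightarrow> ?c * Gamma b - L * (Gamma (b + 1) * 0)"
    using b by (intro tendsto_intros Beta_nat_asymp tendsto_inverse_0_at_top
        filterlim_real_sequentially) auto
  then have lower: "(\<lambda>k. ?c * ?B b k - L * (?B (b + 1) k * inverse (real k))) \<longlonglongrightarrow> ?c * Gamma b"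
    by simp
  show ?thesis
  proof (rule tendsto_sandwich[OF _ _ lower upper])
    show "\<forall>\<^sub>F k in sequentially. ?c * ?B b k - L * (?B (b + 1) k * inverse (real k))
        \<le> moment p b k * real k powr b"
      using eventually_gt_at_top[of 0]
    proof eventually_elim
      case (elim k)
      have "(?c * Beta (real k + 1) b - L * Beta (real k + 1) (b + 1)) * real k powr b
          \<le> moment p b k * real k powr b"
        using moment_ge_Beta[OF p b, of k] unfolding L_def by (intro mult_right_mono) auto
      moreover have "?B (b + 1) k * inverse (real k) = Beta (real k + 1) (b + 1) * real k powr b"
        using elim by (simp add: powr_add)
      ultimately show ?case by (simp only: left_diff_distrib mult.assoc)
    qed
  next
    show "\<forall>\<^sub>F k in sequentially. moment p b k * real k powr b \<le> ?c * ?B b k"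
      using mult_right_mono[OF moment_le_Beta[OF p b]] by (simp add: mult.assoc)
  qed
qed

section \<open>Positivity and boundedness of the moments\<close>

lemma moment_pos:
  assumes p: "1 / 2 < p" "p < 1" and b: "1 < b"
  shows "0 < moment p b k"
proof -
  have nonneg: "0 \<le> t ^ k * weight p b t" if "t \<in> {0..1}" for t
    using that by (simp add: weight_def)
  have "0 \<le> moment p b k"
    unfolding moment_def using nonneg by (intro integral_nonneg integrable_power_weight p b)
  \<comment> \<open>A continuous nonnegative integrand with integral 0 vanishes everywhere, but this
    one is positive at \<open>1 / 2\<close>.\<close>
  moreover have "moment p b k \<noteq> 0"
  proof
    assume "moment p b k = 0"
    then have "((\<lambda>t. t ^ k * weight p b t) has_integral 0) (cbox 0 1)"
      using has_integral_power_weight[OF p b, of k] by simp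
    moreover have "continuous_on (cbox 0 1) (\<lambda>t. t ^ k * weight p b t)"
      using continuous_on_weight[OF p b] by (auto intro!: continuous_intros)
    ultimately have "(1 / 2) ^ k * weight p b (1 / 2) = 0"
      using nonneg by (intro has_integral_0_cbox_imp_0[of 0 1 "\<lambda>t. t ^ k * weight p b t"]) auto
    then show False
      using denominator_pos[OF p, of "1 / 2"] by (simp add: weight_def)
  qed
  ultimately show ?thesis by simp
qed

lemma moment_antimono:
  assumes p: "1 / 2 < p" "p < 1" and b: "1 < b"
  shows "moment p b k \<le> moment p b 0"
  unfolding moment_def
proof (rule integral_le[OF integrable_power_weight[OF p b] integrable_power_weight[OF p b]])
  fix t :: real assume "t \<in> {0..1}"
  then show "t ^ k * weight p b t \<le> t ^ 0 * weight p b t"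
    by (intro mult_right_mono) (auto simp: weight_def power_le_one)
qed

section \<open>Uniqueness of the bounded solution\<close>

text \<open>
  With increments \<open>\<delta> k = e (k + 1) - e k\<close> the recurrence reads
  \<open>(1 - p) k \<delta> k = p k \<delta> (k - 1) + p e k\<close>, and \<open>p \<ge> 1 - p\<close>.
\<close>

lemma recurrence_linear_growth:
  fixes e :: "nat \<Rightarrow> real"
  assumes p: "1 / 2 < p" "p < 1" and "e 0 = 0" "0 \<le> e 1"
    and rec: "\<And>k. 1 \<le> k \<Longrightarrow>
      (real k + p) * e k = p * real k * e (k - 1) + (1 - p) * real k * e (k + 1)"
  shows "real k * e 1 \<le> e k \<and> e 1 \<le> e (Suc k) - e k"
\<comment> \<open>The two bounds feed each other: the increment gives the next size bound, and the
  size bound makes the term \<open>p * e (Suc k)\<close> in the next increment nonnegative.\<close>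
proof (induction k)
  case 0
  then show ?case using assms by simp
next
  case (Suc k)
  let ?n = "real (Suc k)"
  have step: "?n * e 1 \<le> e (Suc k)"
    using Suc by (simp add: algebra_simps)
  have "0 \<le> ?n * e 1" using \<open>0 \<le> e 1\<close> by simp
  with step have nonneg: "0 \<le> e (Suc k)" by linarith
  have "(1 - p) * e 1 \<le> p * e 1"
    using p \<open>0 \<le> e 1\<close> by (intro mult_right_mono) auto
  also have "\<dots> \<le> p * (e (Suc k) - e k)"
    using p Suc by (intro mult_left_mono) auto
  finally have "?n * ((1 - p) * e 1) \<le> ?n * (p * (e (Suc k) - e k))"
    by (intro mult_left_mono) auto
  also have "\<dots> \<le> ?n * (p * (e (Suc k) - e k)) + p * e (Suc k)"
    using p nonneg by simp
  also have "\<dots> = ?n * ((1 - p) * (e (Suc (Suc k)) - e (Suc k)))"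
    using rec[of "Suc k"] by (simp add: algebra_simps)
  finally have "?n * (1 - p) * e 1 \<le> ?n * (1 - p) * (e (Suc (Suc k)) - e (Suc k))"
    by (simp only: mult.assoc)
  moreover have "0 < ?n * (1 - p)" using p by simp
  ultimately have "e 1 \<le> e (Suc (Suc k)) - e (Suc k)"
    using mult_le_cancel_left_pos by blast
  with step show ?case by simp
qed

text \<open>A positive \<open>e 1\<close> would force linear growth past \<open>M\<close>. The bound
  is one-sided, so for a difference of two solutions it is applied in both orders.\<close>

lemma bounded_recurrence_nonpos:
  fixes e :: "nat \<Rightarrow> real"
  assumes p: "1 / 2 < p" "p < 1" and "e 0 = 0" and bdd: "\<And>k. e k \<le> M"
    and rec: "\<And>k. 1 \<le> k \<Longrightarrow>
      (real k + p) * e k = p * real k * e (k - 1) + (1 - p) * real k * e (k + 1)"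
  shows "e 1 \<le> 0"
proof (rule ccontr)
  assume "\<not> e 1 \<le> 0"
  then obtain k :: nat where "M < real k * e 1"
    using reals_Archimedean3[of "e 1"] by auto
  also have "real k * e 1 \<le> e k"
    using recurrence_linear_growth[of p e k] assms \<open>\<not> e 1 \<le> 0\<close> by simp
  finally show False using bdd[of k] by simp
qed

lemma admissible_seq_recurrence:
  assumes "0 < p" "admissible_seq p d" "1 \<le> k"
  shows "(real k + p) * d k = p * real k * d (k - 1) + (1 - p) * real k * d (k + 1)"
proof -
  have "d k = (p * real k * d (k - 1) + (1 - p) * real k * d (k + 1)) / (real k + p)"
    using assms(2,3) unfolding admissible_seq_def by blast
  moreover have "real k + p \<noteq> 0" using assms(1) by simp
  ultimately show ?thesis
    by (metis nonzero_mult_div_cancel_left times_divide_eq_right)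
qed

lemma admissible_seq_unique:
  assumes p: "1 / 2 < p" "p < 1" and c: "admissible_seq p c" and d: "admissible_seq p d"
  shows "c = d"
proof -
  have first_le: "c 1 \<le> d 1" if c: "admissible_seq p c" and d: "admissible_seq p d" for c d
  proof -
    obtain M where M: "\<And>k. \<bar>c k\<bar> \<le> M"
      using c by (auto simp: admissible_seq_def bounded_iff)
    have "c 1 - d 1 \<le> 0"
    proof (rule bounded_recurrence_nonpos[OF p])
      show "c 0 - d 0 = 0" using c d by (simp add: admissible_seq_def)
      \<comment> \<open>Positivity of \<open>d\<close> turns the bound on \<open>c\<close> into an
        upper bound on the difference.\<close>
      have "0 < d k" for k using d by (simp add: admissible_seq_def)
      then show "c k - d k \<le> M" for k
        using M[of k] by (smt (verit))
      show "(real k + p) * (c k - d k)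
          = p * real k * (c (k - 1) - d (k - 1)) + (1 - p) * real k * (c (k + 1) - d (k + 1))"
        if "1 \<le> k" for k
        using admissible_seq_recurrence[OF _ c that] admissible_seq_recurrence[OF _ d that] p
        by (simp add: algebra_simps)
    qed
    then show ?thesis by simp
  qed
  \<comment> \<open>The recurrence has order two, so the induction carries two consecutive
    values.\<close>
  have "c k = d k \<and> c (Suc k) = d (Suc k)" for k
  proof (induction k)
    case 0
    have "c 0 = d 0" using c d by (simp add: admissible_seq_def)
    then show ?case using first_le[OF c d] first_le[OF d c] by simp
  next
    case (Suc k)
    have "(1 - p) * real (Suc k) * c (Suc (Suc k)) = (1 - p) * real (Suc k) * d (Suc (Suc k))"
      using admissible_seq_recurrence[OF _ c, of "Suc k"]
        admissible_seq_recurrence[OF _ d, of "Suc k"] p Suc by simp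
    moreover have "(1 - p) * real (Suc k) \<noteq> 0" using p by simp
    ultimately show ?case using Suc mult_left_cancel by blast
  qed
  then show ?thesis by auto
qed

section \<open>Existence and the asymptotic constant\<close>

text \<open>The recurrence is homogeneous, so scaling preserves it; the factor is forced by
  \<open>d 0 = (1 - p) / p\<close> and \<open>p * moment p b 0 = p powr (- b)\<close>.\<close>

lemma admissible_seq_moment:
  assumes p: "1 / 2 < p" "p < 1" and b: "b = p / (2 * p - 1)" "1 < b"
  shows "admissible_seq p (\<lambda>k. (1 - p) * p powr b * moment p b k)"
    (is "admissible_seq p (\<lambda>k. ?C * _ k)")
  unfolding admissible_seq_def
proof (intro conjI allI impI)
  have C: "0 < ?C" using p by simp
  show pos: "0 < ?C * moment p b k" for k
    using moment_pos[OF p b(2)] C by simp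
  have "\<bar>?C * moment p b k\<bar> \<le> ?C * moment p b 0" for k
    using pos[of k] moment_antimono[OF p b(2), of k] C by (simp add: mult_left_mono)
  then show "bounded (range (\<lambda>k. ?C * moment p b k))"
    by (auto simp: bounded_iff)
  have "?C * (p * moment p b 0) = 1 - p"
    unfolding moment_0[OF p b] using p by (simp add: powr_minus)
  then show "?C * moment p b 0 = (1 - p) / p"
    using p by (simp add: field_simps)
  fix k :: nat assume "1 \<le> k"
  have "(real k + p) * (?C * moment p b k)
      = ?C * ((real k + p) * moment p b k)" by (simp only: mult_ac)
  also have "\<dots> = p * real k * (?C * moment p b (k - 1))
      + (1 - p) * real k * (?C * moment p b (k + 1))"
    unfolding moment_recurrence[OF p b \<open>1 \<le> k\<close>] by (simp add: algebra_simps)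
  finally show "?C * moment p b k = (p * real k * (?C * moment p b (k - 1))
      + (1 - p) * real k * (?C * moment p b (k + 1))) / (real k + p)"
    using p by (simp add: eq_divide_eq mult.commute)
qed

theorem theorem4p3:
  fixes p \<beta> \<gamma> :: real
  assumes "1 / 2 < p" and "p < 1"
    and "\<beta> = p / (2 * p - 1)"
    and "\<gamma> = (1 - p) / p"
  shows "(\<exists>!d. admissible_seq p d) \<and>
    (\<forall>d. admissible_seq p d \<longrightarrow>
       asymp_equiv d sequentially
         (\<lambda>k. \<gamma> * \<beta> powr \<beta> * Gamma (\<beta> + 1) * real k powr (- \<beta>)))"
proof -
  note p = assms(1,2)
  have \<beta>: "1 < \<beta>" unfolding assms(3) using p by simp
  define D where "D k = (1 - p) * p powr \<beta> * moment p \<beta> k" for k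
  define A where "A = \<gamma> * \<beta> powr \<beta> * Gamma (\<beta> + 1)"
  have D: "admissible_seq p D"
    unfolding D_def by (rule admissible_seq_moment[OF p assms(3) \<beta>])
  \<comment> \<open>This matches \<open>A\<close> with the scaled limit of the moments:
    \<open>\<beta> powr \<beta>\<close> splits into powers of \<open>p\<close> and
    \<open>2 * p - 1\<close>, \<open>Gamma (\<beta> + 1)\<close> releases a factor
    \<open>\<beta>\<close>, and \<open>\<gamma> * (2 * p - 1) * \<beta> = 1 - p\<close>.\<close>
  have A: "A = (1 - p) * p powr \<beta> * ((2 * p - 1) powr (- \<beta> - 1) * Gamma \<beta>)"
  proof -
    have "\<beta> powr \<beta> = (p / (2 * p - 1)) powr \<beta>"
      using assms(3) by (rule arg_cong)
    also have "\<dots> = p powr \<beta> * (2 * p - 1) powr (- \<beta>)"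
      using p by (simp add: powr_divide powr_minus_divide)
    also have "(2 * p - 1) powr (- \<beta>) = (2 * p - 1) powr (- \<beta> - 1) * (2 * p - 1)"
      using p by (simp add: powr_diff)
    finally have pow: "\<beta> powr \<beta> = p powr \<beta> * ((2 * p - 1) powr (- \<beta> - 1) * (2 * p - 1))" .
    have Gam: "Gamma (\<beta> + 1) = \<beta> * Gamma \<beta>"
      using \<beta> by (intro Gamma_plus1) (auto elim!: nonpos_Ints_cases)
    have "\<gamma> * (2 * p - 1) * \<beta> = 1 - p"
      unfolding assms(3,4) using p by simp
    moreover have "A = (\<gamma> * (2 * p - 1) * \<beta>) * p powr \<beta> * ((2 * p - 1) powr (- \<beta> - 1) * Gamma \<beta>)"
      unfolding A_def pow Gam by (simp only: mult_ac)
    ultimately show ?thesis by simp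
  qed
  have "A > 0" using p \<beta> unfolding A by (simp add: Gamma_real_pos)
  have "(\<lambda>k. D k * real k powr \<beta>) \<longlonglongrightarrow> A"
    unfolding D_def A mult.assoc[of "(1 - p) * p powr \<beta>"]
    by (rule tendsto_mult_left[OF moment_asymp[OF p \<beta>]])
  then have "(\<lambda>k. D k * real k powr \<beta> / A) \<longlonglongrightarrow> A / A"
    using \<open>A > 0\<close> by (intro tendsto_intros) auto
  then have lim: "(\<lambda>k. D k / (A * real k powr (- \<beta>))) \<longlonglongrightarrow> 1"
    using \<open>A > 0\<close> by (simp add: powr_minus_divide)
  have "D \<sim>[sequentially] (\<lambda>k. A * real k powr (- \<beta>))"
    using asymp_equivI'[OF lim] .
  \<comment> \<open>By uniqueness, every admissible sequence is \<open>D\<close>.\<close>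
  then show ?thesis
    unfolding A_def using D by (auto dest: admissible_seq_unique[OF p _ D])
qed

end
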